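(* Let $a,c,y\in\mathbb{R}$ satisfy $c<0<a$, $2c+a<0$, $c<-a-c<a$ and $y\in[c,-a-c]$, let $\sigma>0$, and let $x_0$, $w_1$, $w_2$ be the functions defined in the context. Let $\{Z_t\}_{t\ge0}$ be a continuous martingale on a complete probability space $(\Omega,\mathcal{F},\mathbb{P})$ with $Z_0=0$ and $Z_t\in L^\infty(\Omega,\mathcal{F},\mathbb{P})$ for all $t\ge0$, and let $\chi_n$, $n\ge0$, be the processes defined in the context. Then there exists $T_\sigma>0$ such that the series $$\chi(t):=\chi_0(t)+\sum_{n\ge1}\sigma^n\chi_n(t)$$ converges almost surely for any $t\in[0,T_\sigma]$. More precisely, the uniform bound $$\sup_{t\in[0,T_\sigma]}|\chi(t)-x_0(t)|\le\frac{1}{2\mathcal{N}(T_\sigma)}\quad\text{almost surely}$$ holds with $$\mathcal{N}(T):=\|w_2\|_{L^\infty([0,T])}\|w_1\|_{L^1([0,T])}+\|w_1\|_{L^\infty([0,T])}\|w_2\|_{L^1([0,T])}.$$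
   Context: The series is the formal expansion in powers of $\sigma$ of the solution of $\ddot\chi(t)=\chi(t)^2-\mathcal{B}+\sigma\dot Z_t$, $\chi(0)=y$, $\dot\chi(0)=\eta$, where $\mathcal{B}=(a^2+c^2+ac)/3$ and $\eta=\dot x_0(0)$. Its coefficients are: $\chi_0:=x_0$; with $\mathcal{K}(t,s):=w_2(t)w_1(s)-w_1(t)w_2(s)$, $$\chi_1(t):=\int_0^t\mathcal{K}(t,s)\,dZ_s=-\int_0^t\partial_2\mathcal{K}(t,s)Z_s\,ds$$ (the solution of $\ddot\chi_1=2x_0\chi_1+\dot Z$, $\chi_1(0)=\dot\chi_1(0)=0$), where $\partial_2$ denotes differentiation in the second variable; and for $n\ge2$ $$\chi_n(t):=\int_0^t\mathcal{K}(t,s)\Big(\sum_{j=1}^{n-1}\chi_j(s)\chi_{n-j}(s)\Big)ds$$ (the solution of $\ddot\chi_n=2x_0\chi_n+\sum_{j=1}^{n-1}\chi_j\chi_{n-j}$, $\chi_n(0)=\dot\chi_n(0)=0$). Let $q:=\sqrt{\frac{2c+a}{c-a}}\in(0,1)$, $F(\gamma,q):=\int_0^\gamma\frac{d\alpha}{\sqrt{1-q^2\sin^2\alpha}}$, $i_y:=F\big(\arcsin\sqrt{\frac{c-y}{2c+a}},q\big)$, and let $\mathrm{sn},\mathrm{cn},\mathrm{dn}$ be the Jacobi elliptic functions (second argument = modulus $q$). Set $$x_0(t):=c-(a+2c)\,\mathrm{sn}^2\Big(\sqrt{\tfrac{a-c}{6}}\,t+i_y,q\Big).$$ Let $\mathcal{E}(t,q):=\int_0^t\mathrm{dn}^2(s,q)\,ds$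 (Jacobi's Epsilon function) and $$u_1(t):=\mathrm{sn}(t,q)\,\mathrm{cn}(t,q)\,\mathrm{dn}(t,q),$$ $$u_2(t):=\alpha_0+\alpha_1\mathrm{cn}^2(t,q)+\alpha_2\mathrm{cn}^4(t,q)+\big(\beta_0t+\beta_1\mathcal{E}(t,q)\big)u_1(t),$$ with $\alpha_0=-1+q^2$, $\alpha_1=-2q^6+3q^4-5q^2+2$, $\alpha_2=2q^2(q^4-q^2+1)$, $\beta_0=-q^4+3q^2-2$, $\beta_1=2(q^4-q^2+1)$. The functions $w_i(t):=\kappa_i\,u_i\big(\sqrt{\tfrac{a-c}{6}}\,t+i_y\big)$, $i=1,2$, where $\kappa_1,\kappa_2$ are fixed nonzero real constants chosen so that the Wronskian is normalized, $w_1\dot w_2-\dot w_1w_2=1$, are two linearly independent solutions of $\ddot w(t)-2x_0(t)w(t)=0$. *)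

theory Defs
  imports "HOL-Probability.Probability"
begin

text \<open>The second argument is always the modulus \<open>q\<close> (not the parameter \<open>q\<^sup>2\<close>).  The interval integral
  is oriented, so \<open>ellF\<close> and \<open>jepsilon\<close> are the usual odd functions on the whole real line.\<close>

definition ellF :: "real \<Rightarrow> real \<Rightarrow> real" where
  "ellF \<gamma> q = (LBINT \<alpha>=0..\<gamma>. 1 / sqrt (1 - q\<^sup>2 * (sin \<alpha>)\<^sup>2))"

text \<open>For \<open>0 < q < 1\<close> the map \<open>\<lambda>\<gamma>. ellF \<gamma> q\<close> is an increasing bijection of the reals;
  the Jacobi amplitude is its inverse.\<close>

definition jam :: "real \<Rightarrow> real \<Rightarrow> real" where
  "jam t q = (THE \<gamma>. ellF \<gamma> q = t)"

definition jsn :: "real \<Rightarrow> real \<Rightarrow> real" where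
  "jsn t q = sin (jam t q)"

definition jcn :: "real \<Rightarrow> real \<Rightarrow> real" where
  "jcn t q = cos (jam t q)"

definition jdn :: "real \<Rightarrow> real \<Rightarrow> real" where
  "jdn t q = sqrt (1 - q\<^sup>2 * (jsn t q)\<^sup>2)"

definition jepsilon :: "real \<Rightarrow> real \<Rightarrow> real" where
  "jepsilon t q = (LBINT s=0..t. (jdn s q)\<^sup>2)"

definition modulus :: "real \<Rightarrow> real \<Rightarrow> real" where
  "modulus a c = sqrt ((2*c + a) / (c - a))"

definition phase :: "real \<Rightarrow> real \<Rightarrow> real \<Rightarrow> real" where
  "phase a c y = ellF (arcsin (sqrt ((c - y) / (2*c + a)))) (modulus a c)"

definition x0 :: "real \<Rightarrow> real \<Rightarrow> real \<Rightarrow> real \<Rightarrow> real" where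
  "x0 a c y t =
     c - (a + 2*c) * (jsn (sqrt ((a - c) / 6) * t + phase a c y) (modulus a c))\<^sup>2"

definition u1 :: "real \<Rightarrow> real \<Rightarrow> real" where
  "u1 q t = jsn t q * jcn t q * jdn t q"

definition u2 :: "real \<Rightarrow> real \<Rightarrow> real" where
  "u2 q t =
    (let \<alpha>\<^sub>0 = - 1 + q^2;
         \<alpha>\<^sub>1 = - 2 * q^6 + 3 * q^4 - 5 * q^2 + 2;
         \<alpha>\<^sub>2 = 2 * q^2 * (q^4 - q^2 + 1);
         \<beta>\<^sub>0 = - (q^4) + 3 * q^2 - 2;
         \<beta>\<^sub>1 = 2 * (q^4 - q^2 + 1)
     in \<alpha>\<^sub>0 + \<alpha>\<^sub>1 * (jcn t q)^2 + \<alpha>\<^sub>2 * (jcn t q)^4 + (\<beta>\<^sub>0 * t + \<beta>\<^sub>1 * jepsilon t q) * u1 q t)"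

definition w1 :: "real \<Rightarrow> real \<Rightarrow> real \<Rightarrow> real \<Rightarrow> real \<Rightarrow> real" where
  "w1 a c y \<kappa> t = \<kappa> * u1 (modulus a c) (sqrt ((a - c) / 6) * t + phase a c y)"

definition w2 :: "real \<Rightarrow> real \<Rightarrow> real \<Rightarrow> real \<Rightarrow> real \<Rightarrow> real" where
  "w2 a c y \<kappa> t = \<kappa> * u2 (modulus a c) (sqrt ((a - c) / 6) * t + phase a c y)"

definition green_kernel :: "(real \<Rightarrow> real) \<Rightarrow> (real \<Rightarrow> real) \<Rightarrow> real \<Rightarrow> real \<Rightarrow> real" where
  "green_kernel v1 v2 t s = v2 t * v1 s - v1 t * v2 s"

text \<open>\<open>chi_coeff x v1 v2 z n t\<close> is the \<open>n\<close>-th coefficient at time \<open>t\<close> along the noise path \<open>z\<close>.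
  Since \<open>green_kernel v1 v2 t t = 0\<close> and \<open>z 0 = 0\<close>, the integral of \<open>green_kernel v1 v2 t\<close> against \<open>dz\<close> is
  the Lebesgue integral in the second equation (integration by parts), which is defined pathwise.\<close>

fun chi_coeff ::
  "(real \<Rightarrow> real) \<Rightarrow> (real \<Rightarrow> real) \<Rightarrow> (real \<Rightarrow> real) \<Rightarrow> (real \<Rightarrow> real) \<Rightarrow> nat \<Rightarrow> real \<Rightarrow> real" where
  "chi_coeff x v1 v2 z 0 t = x t"
| "chi_coeff x v1 v2 z (Suc 0) t = - (LBINT s=0..t. deriv (\<lambda>r. green_kernel v1 v2 t r) s * z s)"
| "chi_coeff x v1 v2 z (Suc (Suc n)) t =
     (LBINT s=0..t. green_kernel v1 v2 t s *
        (\<Sum>j=1..Suc n. chi_coeff x v1 v2 z j s * chi_coeff x v1 v2 z (Suc (Suc n) - j) s))"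

definition Linf_norm :: "'a measure \<Rightarrow> ('a \<Rightarrow> real) \<Rightarrow> ereal" where
  "Linf_norm M f = esssup M (\<lambda>x. ereal \<bar>f x\<bar>)"

definition in_Linf :: "'a measure \<Rightarrow> ('a \<Rightarrow> real) \<Rightarrow> bool" where
  "in_Linf M f \<longleftrightarrow> f \<in> borel_measurable M \<and> Linf_norm M f < \<infinity>"

definition L1_norm :: "'a measure \<Rightarrow> ('a \<Rightarrow> real) \<Rightarrow> real" where
  "L1_norm M f = (LINT x|M. \<bar>f x\<bar>)"

definition kernel_bound :: "(real \<Rightarrow> real) \<Rightarrow> (real \<Rightarrow> real) \<Rightarrow> real \<Rightarrow> real" where
  "kernel_bound v1 v2 T =
    (let \<mu> = restrict_space lborel {0..T}
     in real_of_ereal (Linf_norm \<mu> v2) * L1_norm \<mu> v1 + real_of_ereal (Linf_norm \<mu> v1) * L1_norm \<mu> v2)"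

text \<open>Processes and filtrations are indexed by \<open>real\<close>; only times \<open>t \<ge> 0\<close> are constrained.\<close>

definition martingale_on_nonneg ::
  "'a measure \<Rightarrow> (real \<Rightarrow> 'a measure) \<Rightarrow> (real \<Rightarrow> 'a \<Rightarrow> real) \<Rightarrow> bool" where
  "martingale_on_nonneg M F Z \<longleftrightarrow>
     (\<forall>t\<ge>0. subalgebra M (F t)) \<and>
     (\<forall>s t. 0 \<le> s \<and> s \<le> t \<longrightarrow> sets (F s) \<subseteq> sets (F t)) \<and>
     (\<forall>t\<ge>0. Z t \<in> borel_measurable (F t)) \<and>
     (\<forall>t\<ge>0. integrable M (Z t)) \<and>
     (\<forall>s t. 0 \<le> s \<and> s \<le> t \<longrightarrow> (AE \<omega> in M. real_cond_exp M (F s) (Z t) \<omega> = Z s \<omega>))"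

end

theory Submission
  imports Defs
begin

text \<open>The convergence is a pathwise, deterministic fact about noise paths bounded by a constant \<open>B\<close>;
  probability only supplies \<open>B\<close>.

  Write \<open>N\<close> for the kernel bound on the interval from 0 to \<open>T\<close>.  It dominates the norm of the
  integral operator with the Green kernel on bounded functions (\<open>green_kernel_integral_le\<close>), so the
  suprema \<open>b\<^sub>n\<close> of \<open>\<bar>\<sigma>\<^sup>n \<chi>\<^sub>n\<bar>\<close> satisfy \<open>b\<^sub>n \<le> N * (\<Sum>j=1..n-1. b\<^sub>j * b\<^bsub>n-j\<^esub>)\<close>.
  If \<open>b\<^sub>1 \<le> \<beta>\<close>, the partial sums \<open>S\<close> of the corresponding majorant never leave the range up to
  \<open>1 / (2 * N)\<close> when \<open>4 * N * \<beta> \<le> 1\<close>, because \<open>\<beta> + N * S\<^sup>2\<close> maps this range into itself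
  (\<open>scaled_catalan_partial_sum_le\<close>).  This gives convergence and the claimed bound together.

  The smallness condition holds for short times: the fundamental solutions are continuously
  differentiable, so \<open>N\<close> and \<open>\<beta>\<close> are both \<open>O(T)\<close>, the latter with a constant proportional to \<open>B\<close>
  (\<open>perturbation_series_converges_small_time\<close>).  Differentiability comes from the Jacobi functions:
  the amplitude is the inverse function of the elliptic integral \<open>ellF\<close>, whose derivative is at
  least 1.

  Finally, \<open>B\<close> is an almost sure bound of \<open>Z\<close> at time 1.  By the martingale property it bounds each
  earlier \<open>Z t\<close> almost surely, and path continuity makes the exceptional null set independent of
  \<open>t\<close> (\<open>continuous_martingale_uniformly_bounded\<close>).\<close>

section \<open>Regularity of the Jacobi elliptic functions\<close>

lemma C1_differentiable_on_UNIV_iff_DERIV: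
  fixes f :: "real \<Rightarrow> real"
  shows "f C1_differentiable_on UNIV \<longleftrightarrow>
    (\<exists>f'. (\<forall>x. (f has_real_derivative f' x) (at x)) \<and> continuous_on UNIV f')"
  by (simp add: C1_differentiable_on_def has_real_derivative_iff_has_vector_derivative)

lemma C1_differentiable_on_UNIV_I:
  fixes f :: "real \<Rightarrow> real"
  assumes "\<And>x. (f has_real_derivative f' x) (at x)" "continuous_on UNIV f'"
  shows "f C1_differentiable_on UNIV"
  using assms unfolding C1_differentiable_on_UNIV_iff_DERIV by blast

lemma has_real_derivative_interval_integral:
  fixes f :: "real \<Rightarrow> real"
  assumes "continuous_on UNIV f"
  shows "((\<lambda>u. LBINT s=0..u. f s) has_real_derivative f x) (at x)"
proof -
  let ?a = "- \<bar>x\<bar> - 1" and ?b = "\<bar>x\<bar> + 1"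
  have "((\<lambda>u. LBINT s=ereal 0..ereal u. f s) has_vector_derivative f x) (at x within {?a..?b})"
    by (rule interval_integral_FTC2) (use assms continuous_on_subset in auto)
  moreover have "at x within {?a..?b} = at x"
    by (rule at_within_interior) auto
  ultimately show ?thesis
    by (simp add: has_real_derivative_iff_has_vector_derivative zero_ereal_def)
qed

context
  fixes q :: real
  assumes q: "q\<^sup>2 < 1"
begin

lemma modulus_times_sin_less_1: "q\<^sup>2 * (sin x)\<^sup>2 < 1"
proof -
  have "q\<^sup>2 * (sin x)\<^sup>2 \<le> q\<^sup>2 * 1"
    by (intro mult_left_mono) (auto simp: abs_square_le_1)
  with q show ?thesis by simp
qed

lemma ellF_has_derivative:
  "((\<lambda>x. ellF x q) has_real_derivative 1 / sqrt (1 - q\<^sup>2 * (sin x)\<^sup>2)) (at x)"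
  unfolding ellF_def
  by (rule has_real_derivative_interval_integral)
    (use modulus_times_sin_less_1 in \<open>auto intro!: continuous_intros simp: less_imp_neq\<close>)

text \<open>The integrand of \<open>ellF\<close> is at least 1, so \<open>ellF\<close> grows at least linearly.  Injectivity is
  immediate, and surjectivity follows by the intermediate value theorem: \<open>t\<close> lies between the values
  at \<open>- \<bar>t\<bar>\<close> and \<open>\<bar>t\<bar>\<close>.  Hence the amplitude \<open>jam\<close>, defined by a definite description, is the
  two-sided inverse of \<open>ellF\<close>.\<close>

lemma ellF_growth:
  assumes "x \<le> y"
  shows "y - x \<le> ellF y q - ellF x q"
proof -
  have "\<exists>d. ((\<lambda>x. ellF x q - x) has_real_derivative d) (at x) \<and> 0 \<le> d" for x
    by (rule exI[of _ "1 / sqrt (1 - q\<^sup>2 * (sin x)\<^sup>2) - 1"])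
      (use modulus_times_sin_less_1[of x] in \<open>auto intro!: derivative_eq_intros ellF_has_derivative\<close>)
  then have "ellF x q - x \<le> ellF y q - y"
    using DERIV_nonneg_imp_nondecreasing[OF assms, of "\<lambda>x. ellF x q - x"] by blast
  then show ?thesis by simp
qed

lemma jam_ellF: "jam (ellF x q) q = x"
  unfolding jam_def
proof (rule the_equality)
  fix y assume "ellF y q = ellF x q"
  then show "y = x" using ellF_growth[of x y] ellF_growth[of y x] by linarith
qed simp

lemma ellF_jam: "ellF (jam t q) q = t"
proof -
  have [simp]: "ellF 0 q = 0" by (simp add: ellF_def zero_ereal_def)
  have "- \<bar>t\<bar> \<le> 0" "0 \<le> \<bar>t\<bar>" by auto
  then have "ellF (- \<bar>t\<bar>) q \<le> t" "t \<le> ellF \<bar>t\<bar> q"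
    using ellF_growth[of "- \<bar>t\<bar>" 0] ellF_growth[of 0 "\<bar>t\<bar>"] by auto
  moreover have "continuous_on {- \<bar>t\<bar>..\<bar>t\<bar>} (\<lambda>x. ellF x q)"
    using ellF_has_derivative by (meson DERIV_continuous_on has_field_derivative_at_within)
  ultimately obtain x where "ellF x q = t"
    using IVT'[of "\<lambda>x. ellF x q" "- \<bar>t\<bar>" t "\<bar>t\<bar>"] by auto
  then show ?thesis using jam_ellF by metis
qed

text \<open>By the inverse function rule; the reciprocal of the integrand of \<open>ellF\<close> at the amplitude is \<open>dn\<close>.\<close>

lemma jam_has_derivative: "((\<lambda>t. jam t q) has_real_derivative jdn t q) (at t)"
proof -
  let ?d = "1 / sqrt (1 - q\<^sup>2 * (sin (jam t q))\<^sup>2)"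
  have d: "?d \<noteq> 0" using modulus_times_sin_less_1[of "jam t q"] by simp
  have "((\<lambda>t. jam t q) has_derivative (\<lambda>h. inverse ?d * h)) (at (ellF (jam t q) q))"
  proof (rule has_derivative_inverse_strong[of UNIV "jam t q" "\<lambda>x. ellF x q" "\<lambda>t. jam t q" "\<lambda>h. ?d * h"])
    show "continuous_on UNIV (\<lambda>x. ellF x q)"
      using ellF_has_derivative by (meson DERIV_continuous_on has_field_derivative_at_within)
    show "((\<lambda>x. ellF x q) has_derivative (*) ?d) (at (jam t q))"
      using ellF_has_derivative unfolding has_field_derivative_def .
    show "(\<lambda>h. ?d * h) \<circ> (\<lambda>h. inverse ?d * h) = id"
      using d by (auto simp: fun_eq_iff)
  qed (auto simp: jam_ellF)
  then show ?thesis
    by (simp add: ellF_jam has_field_derivative_def jdn_def jsn_def)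
qed

lemma jdn_pos: "0 < jdn t q"
  using modulus_times_sin_less_1[of "jam t q"] by (simp add: jdn_def jsn_def)

lemma jsn_has_derivative: "((\<lambda>t. jsn t q) has_real_derivative jcn t q * jdn t q) (at t)"
  unfolding jsn_def jcn_def by (auto intro!: derivative_eq_intros jam_has_derivative)

lemma jcn_has_derivative: "((\<lambda>t. jcn t q) has_real_derivative - jsn t q * jdn t q) (at t)"
  unfolding jsn_def jcn_def by (auto intro!: derivative_eq_intros jam_has_derivative)

lemma jdn_has_derivative: "((\<lambda>t. jdn t q) has_real_derivative - q\<^sup>2 * jsn t q * jcn t q) (at t)"
proof -
  have pos: "0 < 1 - q\<^sup>2 * (jsn t q)\<^sup>2"
    using modulus_times_sin_less_1[of "jam t q"] by (simp add: jsn_def)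
  have "((\<lambda>t. 1 - q\<^sup>2 * (jsn t q)\<^sup>2) has_real_derivative
      - (2 * q\<^sup>2 * jsn t q * (jcn t q * jdn t q))) (at t)"
    by (auto intro!: derivative_eq_intros jsn_has_derivative)
  from DERIV_chain2[OF DERIV_real_sqrt[OF pos] this]
  have "((\<lambda>t. jdn t q) has_real_derivative
      inverse (jdn t q) / 2 * - (2 * q\<^sup>2 * jsn t q * (jcn t q * jdn t q))) (at t)"
    by (simp only: jdn_def)
  moreover have "inverse (jdn t q) / 2 * - (2 * q\<^sup>2 * jsn t q * (jcn t q * jdn t q))
      = - q\<^sup>2 * jsn t q * jcn t q"
    using jdn_pos[of t] by (simp add: field_simps)
  ultimately show ?thesis
    by (simp only:)
qed

lemma continuous_on_jacobi:
  "continuous_on UNIV (\<lambda>t. jsn t q)" "continuous_on UNIV (\<lambda>t. jcn t q)" "continuous_on UNIV (\<lambda>t. jdn t q)"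
  using jsn_has_derivative jcn_has_derivative jdn_has_derivative
  by (meson DERIV_isCont continuous_at_imp_continuous_on)+

lemma jepsilon_has_derivative: "((\<lambda>t. jepsilon t q) has_real_derivative (jdn t q)\<^sup>2) (at t)"
  unfolding jepsilon_def
  by (rule has_real_derivative_interval_integral) (intro continuous_intros continuous_on_jacobi)

lemma C1_differentiable_jacobi:
  "(\<lambda>t. jsn t q) C1_differentiable_on UNIV" "(\<lambda>t. jcn t q) C1_differentiable_on UNIV"
  "(\<lambda>t. jdn t q) C1_differentiable_on UNIV" "(\<lambda>t. jepsilon t q) C1_differentiable_on UNIV"
  by (rule C1_differentiable_on_UNIV_I, rule jsn_has_derivative jcn_has_derivative jdn_has_derivative
      jepsilon_has_derivative, intro continuous_intros continuous_on_jacobi)+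

lemma C1_differentiable_u1: "u1 q C1_differentiable_on UNIV"
  unfolding u1_def by (intro C1_differentiable_on_mult C1_differentiable_jacobi)

lemma C1_differentiable_u2: "u2 q C1_differentiable_on UNIV"
  unfolding u2_def Let_def power4_eq_xxxx[of "jcn _ _"] power2_eq_square[of "jcn _ _"]
  by (intro C1_differentiable_on_add C1_differentiable_on_mult C1_differentiable_on_const
      C1_differentiable_on_ident C1_differentiable_jacobi C1_differentiable_u1)

end

lemma modulus_square_less_1:
  assumes "c < - a - c" "- a - c < a" "2 * c + a < 0"
  shows "(modulus a c)\<^sup>2 < 1"
proof -
  have "0 \<le> (2 * c + a) / (c - a)" "(2 * c + a) / (c - a) < 1"
    using assms by (auto simp: divide_simps)
  then show ?thesis by (simp add: modulus_def)
qed

lemma C1_differentiable_on_compose_affine: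
  fixes f :: "real \<Rightarrow> real"
  assumes "f C1_differentiable_on UNIV"
  shows "(\<lambda>t. f (m * t + b)) C1_differentiable_on UNIV"
proof -
  obtain f' where f': "\<And>x. (f has_real_derivative f' x) (at x)" "continuous_on UNIV f'"
    using assms unfolding C1_differentiable_on_UNIV_iff_DERIV by blast
  have "((\<lambda>t. f (m * t + b)) has_real_derivative f' (m * t + b) * m) (at t)" for t
    by (rule DERIV_chain2[where g = "\<lambda>t. m * t + b", OF f'(1)]) (auto intro!: derivative_eq_intros)
  moreover have "continuous_on UNIV (\<lambda>t. f' (m * t + b) * m)"
    by (intro continuous_intros continuous_on_compose2[OF f'(2)]) auto
  ultimately show ?thesis
    by (rule C1_differentiable_on_UNIV_I)
qed

lemma C1_differentiable_w1:
  "(modulus a c)\<^sup>2 < 1 \<Longrightarrow> w1 a c y \<kappa> C1_differentiable_on UNIV"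
  unfolding w1_def
  by (intro C1_differentiable_on_mult C1_differentiable_on_const
      C1_differentiable_on_compose_affine C1_differentiable_u1)

lemma C1_differentiable_w2:
  "(modulus a c)\<^sup>2 < 1 \<Longrightarrow> w2 a c y \<kappa> C1_differentiable_on UNIV"
  unfolding w2_def
  by (intro C1_differentiable_on_mult C1_differentiable_on_const
      C1_differentiable_on_compose_affine C1_differentiable_u2)

section \<open>Majorizing a quadratic recursion\<close>

text \<open>\<open>scaled_catalan N \<beta> n = N ^ n * \<beta> ^ Suc n * C\<close> with \<open>C\<close> the \<open>n\<close>-th Catalan number.\<close>

fun scaled_catalan :: "real \<Rightarrow> real \<Rightarrow> nat \<Rightarrow> real" where
  "scaled_catalan N \<beta> 0 = \<beta>"
| "scaled_catalan N \<beta> (Suc n) = N * (\<Sum>j\<le>n. scaled_catalan N \<beta> j * scaled_catalan N \<beta> (n - j))"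

lemma scaled_catalan_nonneg:
  assumes "0 \<le> N" "0 \<le> \<beta>"
  shows "0 \<le> scaled_catalan N \<beta> n"
proof (induction n rule: less_induct)
  case (less n)
  show ?case
  proof (cases n)
    case (Suc m)
    then have "0 \<le> (\<Sum>j\<le>m. scaled_catalan N \<beta> j * scaled_catalan N \<beta> (m - j))"
      by (intro sum_nonneg mult_nonneg_nonneg less.IH) auto
    then show ?thesis using assms Suc by simp
  qed (use assms in simp)
qed

lemma sum_convolution_le_square:
  fixes b :: "nat \<Rightarrow> real"
  assumes "\<And>n. 0 \<le> b n"
  shows "(\<Sum>k<n. \<Sum>j\<le>k. b j * b (k - j)) \<le> (\<Sum>k<n. b k)\<^sup>2"
proof -
  have "(\<Sum>k<n. \<Sum>j\<le>k. b j * b (k - j)) = (\<Sum>(i, j)\<in>{(i, j). i + j < n}. b i * b j)"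
    by (rule sum.triangle_reindex[symmetric])
  also have "\<dots> \<le> (\<Sum>(i, j)\<in>{..<n} \<times> {..<n}. b i * b j)"
    using assms by (intro sum_mono2) auto
  also have "\<dots> = (\<Sum>k<n. b k)\<^sup>2"
    by (simp add: power2_eq_square sum_product sum.cartesian_product)
  finally show ?thesis .
qed

text \<open>The partial sums satisfy \<open>S\<^bsub>n+1\<^esub> \<le> \<beta> + N * S\<^bsub>n\<^esub>\<^sup>2\<close>, and this quadratic map preserves the interval
  from 0 to \<open>1 / (2 * N)\<close> as soon as \<open>\<beta> \<le> 1 / (4 * N)\<close>.\<close>

lemma scaled_catalan_partial_sum_le:
  assumes N: "0 < N" and \<beta>: "0 \<le> \<beta>" and small: "4 * N * \<beta> \<le> 1"
  shows "(\<Sum>k<n. scaled_catalan N \<beta> k) \<le> 1 / (2 * N)"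
proof (induction n)
  case 0
  show ?case using N by simp
next
  case (Suc n)
  let ?b = "scaled_catalan N \<beta>" and ?S = "\<Sum>k<n. scaled_catalan N \<beta> k"
  have nonneg: "0 \<le> ?b k" for k
    using scaled_catalan_nonneg N \<beta> by simp
  have "(\<Sum>k<Suc n. ?b k) = \<beta> + N * (\<Sum>k<n. \<Sum>j\<le>k. ?b j * ?b (k - j))"
    by (subst sum.lessThan_Suc_shift) (simp add: sum_distrib_left)
  also have "\<dots> \<le> \<beta> + N * ?S\<^sup>2"
    using N sum_convolution_le_square[of ?b n, OF nonneg] by simp
  also have "\<dots> \<le> 1 / (4 * N) + N * (1 / (2 * N))\<^sup>2"
    using N small Suc.IH nonneg
    by (intro add_mono mult_left_mono power_mono sum_nonneg) (auto simp: field_simps)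
  also have "\<dots> = 1 / (2 * N)"
    using N by (simp add: field_simps power2_eq_square)
  finally show ?case .
qed

lemma dominated_by_scaled_catalan:
  fixes g :: "nat \<Rightarrow> real"
  assumes N: "0 < N" and \<beta>: "0 \<le> \<beta>" and small: "4 * N * \<beta> \<le> 1"
    and g: "\<And>n. \<bar>g n\<bar> \<le> scaled_catalan N \<beta> n"
  shows "summable g" and "\<bar>\<Sum>n. g n\<bar> \<le> 1 / (2 * N)"
proof -
  have partial_sums: "(\<Sum>k<n. \<bar>g k\<bar>) \<le> 1 / (2 * N)" for n
    using sum_mono[of "{..<n}", OF g] scaled_catalan_partial_sum_le[OF N \<beta> small, of n]
    by (rule order_trans)
  have abs_summable: "summable (\<lambda>n. \<bar>g n\<bar>)"
    using partial_sums[of "Suc _"] by (intro bounded_imp_summable) (auto simp: lessThan_Suc_atMost)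
  then show "summable g" by (rule summable_rabs_cancel)
  have "\<bar>\<Sum>n. g n\<bar> \<le> (\<Sum>n. \<bar>g n\<bar>)"
    using abs_summable by (rule summable_rabs)
  also have "\<dots> \<le> 1 / (2 * N)"
    using abs_summable partial_sums by (rule suminf_le_const)
  finally show "\<bar>\<Sum>n. g n\<bar> \<le> 1 / (2 * N)" .
qed

section \<open>The bound of the Green kernel\<close>

text \<open>A nonintegrable \<open>f\<close> has integral 0 by convention and satisfies the bound trivially.  So the
  iterated integrals defining the coefficients can be estimated along every bounded noise path,
  measurable or not.\<close>

lemma abs_set_integral_le:
  fixes f g :: "'a \<Rightarrow> real"
  assumes "set_integrable M A g" and "\<And>x. x \<in> A \<Longrightarrow> \<bar>f x\<bar> \<le> g x"
  shows "\<bar>LINT x:A|M. f x\<bar> \<le> (LINT x:A|M. g x)"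
proof (cases "set_integrable M A f")
  case True
  have "norm (LINT x:A|M. f x) \<le> (LINT x:A|M. norm (f x))"
    using True by (rule set_integral_norm_bound)
  also have "\<dots> \<le> (LINT x:A|M. g x)"
    using assms True by (intro set_integral_mono set_integrable_norm) auto
  finally show ?thesis by simp
next
  case False
  have "0 \<le> g x" if "x \<in> A" for x
    using assms(2)[OF that] by linarith
  then have "0 \<le> (LINT x:A|M. g x)"
    unfolding set_lebesgue_integral_def by (intro integral_nonneg_AE) (auto simp: indicator_def)
  then show ?thesis
    using False by (simp add: set_lebesgue_integral_def set_integrable_def not_integrable_integral_eq)
qed

lemma set_integrable_continuous:
  fixes v :: "real \<Rightarrow> real"
  assumes "continuous_on UNIV v"
  shows "set_integrable lborel {a..b} v"
  using borel_integrable_atLeastAtMost'[of a b v] assms continuous_on_subset by blast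

lemma continuous_on_interval_abs_bounded:
  fixes f :: "real \<Rightarrow> real"
  assumes "continuous_on UNIV f"
  obtains A where "\<And>s. s \<in> {a..b} \<Longrightarrow> \<bar>f s\<bar> \<le> A"
proof -
  have "compact (f ` {a..b})"
    using assms continuous_on_subset by (intro compact_continuous_image) auto
  then show ?thesis
    using that compact_imp_bounded bounded_real by (metis image_eqI)
qed

lemma L1_norm_interval:
  fixes v :: "real \<Rightarrow> real"
  shows "L1_norm (restrict_space lborel {0..T}) v = (LBINT s:{0..T}. \<bar>v s\<bar>)"
  unfolding L1_norm_def set_lebesgue_integral_def by (rule integral_restrict_space) simp

text \<open>The exceptional set is relatively open, so it is empty on the open interval once it is null; the
  endpoints are limits.\<close>

lemma continuous_le_if_AE_le_interval:
  fixes g :: "real \<Rightarrow> real"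
  assumes cont: "continuous_on UNIV g" and "0 < T"
    and AE: "AE s in lborel. s \<in> {0..T} \<longrightarrow> g s \<le> A" and t: "t \<in> {0..T}"
  shows "g t \<le> A"
proof -
  let ?C = "{s. g s \<le> A}"
  have closed: "closed ?C"
    using cont by (intro closed_Collect_le) auto
  have "s \<in> ?C" if "s \<in> {0<..<T}" for s
  proof (rule mem_closed_if_AE_lebesgue_open[OF _ closed _ that])
    show "AE s\<in>{0<..<T} in lebesgue. s \<in> ?C"
      using AE by (intro AE_completion) (auto elim!: eventually_mono)
  qed simp
  then have "closure {0<..<T} \<subseteq> ?C"
    using closed by (intro closure_minimal) auto
  then show ?thesis using t \<open>0 < T\<close> by auto
qed

context
  fixes v :: "real \<Rightarrow> real" and T :: real
  assumes cont: "continuous_on UNIV v" and T: "0 < T"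
begin

lemma Linf_norm_le:
  assumes "\<And>t. t \<in> {0..T} \<Longrightarrow> \<bar>v t\<bar> \<le> A"
  shows "Linf_norm (restrict_space lborel {0..T}) v \<le> ereal A"
  unfolding Linf_norm_def
proof (rule esssup_I)
  have [measurable]: "v \<in> borel_measurable lborel"
    using cont borel_measurable_continuous_onI by simp
  show "(\<lambda>x. ereal \<bar>v x\<bar>) \<in> borel_measurable (restrict_space lborel {0..T})"
    by (intro measurable_restrict_space1) measurable
  show "AE x in restrict_space lborel {0..T}. ereal \<bar>v x\<bar> \<le> ereal A"
    by (rule AE_I2) (use assms in \<open>auto simp: space_restrict_space\<close>)
qed

text \<open>The essential supremum over a null space is \<open>- \<infinity>\<close>; \<open>0 < T\<close> excludes this degenerate value.\<close>

lemma Linf_norm_nonneg: "0 \<le> Linf_norm (restrict_space lborel {0..T}) v"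
proof (rule ccontr)
  assume "\<not> 0 \<le> Linf_norm (restrict_space lborel {0..T}) v"
  then have neg: "Linf_norm (restrict_space lborel {0..T}) v < 0" by simp
  have "AE s in restrict_space lborel {0..T}. ereal \<bar>v s\<bar> \<le> Linf_norm (restrict_space lborel {0..T}) v"
    unfolding Linf_norm_def by (rule esssup_AE)
  then have "AE s in restrict_space lborel {0..T}. False"
  proof (rule eventually_mono)
    fix s assume "ereal \<bar>v s\<bar> \<le> Linf_norm (restrict_space lborel {0..T}) v"
    from this neg have "ereal \<bar>v s\<bar> < 0" by (rule le_less_trans)
    then show False by simp
  qed
  then have "AE s in lborel. s \<in> {0..T} \<longrightarrow> (1::real) \<le> 0"
    by (subst (asm) AE_restrict_space_iff) auto
  from continuous_le_if_AE_le_interval[OF _ T this, of 0] T show False by simp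
qed

lemma Linf_norm_finite: "\<bar>Linf_norm (restrict_space lborel {0..T}) v\<bar> \<noteq> \<infinity>"
proof -
  obtain A where "\<And>t. t \<in> {0..T} \<Longrightarrow> \<bar>v t\<bar> \<le> A"
    using continuous_on_interval_abs_bounded[OF cont, of 0 T] by blast
  then have "Linf_norm (restrict_space lborel {0..T}) v \<le> ereal A" by (rule Linf_norm_le)
  with Linf_norm_nonneg show ?thesis by auto
qed

lemma abs_le_Linf_norm:
  assumes "t \<in> {0..T}"
  shows "\<bar>v t\<bar> \<le> real_of_ereal (Linf_norm (restrict_space lborel {0..T}) v)"
proof (rule continuous_le_if_AE_le_interval[OF _ T _ assms])
  show "continuous_on UNIV (\<lambda>s. \<bar>v s\<bar>)" using cont by (intro continuous_intros)
  have "AE s in restrict_space lborel {0..T}. ereal \<bar>v s\<bar> \<le> Linf_norm (restrict_space lborel {0..T}) v"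
    unfolding Linf_norm_def by (rule esssup_AE)
  then have "AE s in restrict_space lborel {0..T}. \<bar>v s\<bar> \<le> real_of_ereal (Linf_norm (restrict_space lborel {0..T}) v)"
    by (rule eventually_mono) (use Linf_norm_finite in \<open>metis ereal_less_eq(3) ereal_real'\<close>)
  then show "AE s in lborel. s \<in> {0..T} \<longrightarrow> \<bar>v s\<bar> \<le> real_of_ereal (Linf_norm (restrict_space lborel {0..T}) v)"
    by (subst (asm) AE_restrict_space_iff) auto
qed

lemma real_Linf_norm_le:
  assumes "\<And>t. t \<in> {0..T} \<Longrightarrow> \<bar>v t\<bar> \<le> A"
  shows "real_of_ereal (Linf_norm (restrict_space lborel {0..T}) v) \<le> A"
  using Linf_norm_le[OF assms] Linf_norm_finite by (metis ereal_less_eq(3) ereal_real')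

lemma set_integrable_abs: "set_integrable lborel {a..b} (\<lambda>s. \<bar>v s\<bar>)"
  using cont by (intro set_integrable_continuous continuous_intros)

lemma L1_norm_nonneg: "0 \<le> L1_norm (restrict_space lborel {0..T}) v"
  unfolding L1_norm_def by simp

lemma L1_norm_le:
  assumes "\<And>t. t \<in> {0..T} \<Longrightarrow> \<bar>v t\<bar> \<le> A"
  shows "L1_norm (restrict_space lborel {0..T}) v \<le> A * T"
proof -
  have "L1_norm (restrict_space lborel {0..T}) v \<le> (LBINT s:{0..T}. A)"
    unfolding L1_norm_interval using assms
    by (intro set_integral_mono set_integrable_abs set_integrable_continuous) auto
  also have "\<dots> = A * T" using T by (simp add: set_lebesgue_integral_def)
  finally show ?thesis .
qed

lemma L1_norm_pos:
  assumes "t \<in> {0..T}" "v t \<noteq> 0"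
  shows "0 < L1_norm (restrict_space lborel {0..T}) v"
proof -
  have "L1_norm (restrict_space lborel {0..T}) v \<noteq> 0"
  proof
    assume "L1_norm (restrict_space lborel {0..T}) v = 0"
    then have "(LINT s|lborel. indicator {0..T} s * \<bar>v s\<bar>) = 0"
      by (simp add: L1_norm_interval set_lebesgue_integral_def)
    moreover have "integrable lborel (\<lambda>s. indicator {0..T} s * \<bar>v s\<bar>)"
      using set_integrable_abs[of 0 T] by (simp add: set_integrable_def)
    ultimately have "AE s in lborel. indicator {0..T} s * \<bar>v s\<bar> = 0"
      by (subst (asm) integral_nonneg_eq_0_iff_AE) auto
    then have "AE s in lborel. s \<in> {0..T} \<longrightarrow> \<bar>v s\<bar> \<le> 0"
      by (rule eventually_mono) auto
    with continuous_le_if_AE_le_interval[OF _ T this assms(1)] cont assms(2)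
    show False by (auto intro: continuous_intros)
  qed
  with L1_norm_nonneg show ?thesis by simp
qed

lemma integral_abs_le_L1_norm:
  assumes "t \<in> {0..T}"
  shows "(LBINT s:{0..t}. \<bar>v s\<bar>) \<le> L1_norm (restrict_space lborel {0..T}) v"
  unfolding L1_norm_interval set_lebesgue_integral_def
proof (rule integral_mono)
  show "indicator {0..t} s *\<^sub>R \<bar>v s\<bar> \<le> indicator {0..T} s *\<^sub>R \<bar>v s\<bar>" for s
    using assms by (auto simp: indicator_def)
qed (use set_integrable_abs in \<open>simp_all add: set_integrable_def\<close>)

end

context
  fixes v1 v2 :: "real \<Rightarrow> real" and T :: real
  assumes cont: "continuous_on UNIV v1" "continuous_on UNIV v2" and T: "0 < T"
begin

lemma kernel_bound_le:
  assumes "\<And>t. t \<in> {0..T} \<Longrightarrow> \<bar>v1 t\<bar> \<le> A" "\<And>t. t \<in> {0..T} \<Longrightarrow> \<bar>v2 t\<bar> \<le> A"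
  shows "kernel_bound v1 v2 T \<le> 2 * A\<^sup>2 * T"
proof -
  have "0 \<le> A" using assms(1)[of 0] T by auto
  then have "kernel_bound v1 v2 T \<le> A * (A * T) + A * (A * T)"
    unfolding kernel_bound_def Let_def
    by (intro add_mono mult_mono real_Linf_norm_le L1_norm_le L1_norm_nonneg cont T assms)
  then show ?thesis by (simp add: power2_eq_square algebra_simps)
qed

lemma kernel_bound_pos:
  assumes "t1 \<in> {0..T}" "v1 t1 \<noteq> 0" "t2 \<in> {0..T}" "v2 t2 \<noteq> 0"
  shows "0 < kernel_bound v1 v2 T"
  unfolding kernel_bound_def Let_def
proof (intro add_pos_pos mult_pos_pos)
  show "0 < real_of_ereal (Linf_norm (restrict_space lborel {0..T}) v1)"
    using abs_le_Linf_norm[OF cont(1) T assms(1)] assms(2) by linarith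
  show "0 < real_of_ereal (Linf_norm (restrict_space lborel {0..T}) v2)"
    using abs_le_Linf_norm[OF cont(2) T assms(3)] assms(4) by linarith
qed (use L1_norm_pos cont T assms in blast)+

text \<open>Since the kernel is a difference of two products, the sup norm bounds its factors in \<open>t\<close> and
  the \<open>L\<^sup>1\<close> norm those in \<open>s\<close>: this is where \<open>kernel_bound\<close> comes from.\<close>

lemma green_kernel_integral_le:
  assumes t: "t \<in> {0..T}"
    and h: "\<And>s. s \<in> {0..t} \<Longrightarrow> \<bar>h s\<bar> \<le> H"
  shows "\<bar>LBINT s=0..t. green_kernel v1 v2 t s * h s\<bar> \<le> kernel_bound v1 v2 T * H"
proof -
  let ?I = "\<lambda>v. LBINT s:{0..t}. \<bar>v s\<bar>"
  have H: "0 \<le> H" using h[of 0] t by auto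
  let ?g = "\<lambda>s. \<bar>v2 t\<bar> * H * \<bar>v1 s\<bar> + \<bar>v1 t\<bar> * H * \<bar>v2 s\<bar>"
  have "\<bar>green_kernel v1 v2 t s * h s\<bar> \<le> ?g s" if "s \<in> {0..t}" for s
  proof -
    have "\<bar>green_kernel v1 v2 t s * h s\<bar> \<le> (\<bar>v2 t * v1 s\<bar> + \<bar>v1 t * v2 s\<bar>) * H"
      unfolding green_kernel_def abs_mult[of _ "h s"]
      using h[OF that] H by (intro mult_mono) auto
    then show ?thesis by (simp add: abs_mult algebra_simps)
  qed
  then have "\<bar>LBINT s:{0..t}. green_kernel v1 v2 t s * h s\<bar> \<le> (LBINT s:{0..t}. ?g s)"
    using cont by (intro abs_set_integral_le set_integrable_continuous continuous_intros) auto
  also have "\<dots> = \<bar>v2 t\<bar> * H * ?I v1 + \<bar>v1 t\<bar> * H * ?I v2"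
    using cont
    by (subst set_integral_add(2))
      (auto simp: set_integral_mult_right intro!: set_integrable_continuous continuous_intros)
  also have "\<dots> \<le> kernel_bound v1 v2 T * H"
  proof -
    have I: "?I v * (\<bar>w t\<bar> * H) \<le> L1_norm (restrict_space lborel {0..T}) v
        * (real_of_ereal (Linf_norm (restrict_space lborel {0..T}) w) * H)"
      if "continuous_on UNIV v" "continuous_on UNIV w" for v w
      using H t
      by (intro mult_mono mult_right_mono integral_abs_le_L1_norm abs_le_Linf_norm L1_norm_nonneg
          that T mult_nonneg_nonneg) auto
    from I[OF cont] I[OF cont(2,1)] show ?thesis
      unfolding kernel_bound_def Let_def by (simp add: algebra_simps)
  qed
  finally show ?thesis
    using t by (simp add: interval_integral_Icc zero_ereal_def)
qed

end

section \<open>Pathwise convergence for small times\<close>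

text \<open>Shifting both indices by one turns the source term into the convolution in the recursion of
  \<open>scaled_catalan\<close>.\<close>

lemma chi_coeff_convolution:
  "chi_coeff x v1 v2 z (Suc (Suc n)) t =
     (LBINT s=0..t. green_kernel v1 v2 t s *
        (\<Sum>j\<le>n. chi_coeff x v1 v2 z (Suc j) s * chi_coeff x v1 v2 z (Suc (n - j)) s))"
proof -
  have "(\<Sum>j=1..Suc n. f j * f (Suc (Suc n) - j)) = (\<Sum>j\<le>n. f (Suc j) * f (Suc (n - j)))"
    for f :: "nat \<Rightarrow> real"
    unfolding One_nat_def sum.shift_bounds_cl_Suc_ivl
    by (intro sum.cong) (auto simp: atLeast0AtMost Suc_diff_le)
  from this[of "\<lambda>j. chi_coeff x v1 v2 z j _"] show ?thesis
    unfolding chi_coeff.simps(3) by (simp only:)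
qed

declare chi_coeff.simps [simp del]

lemma chi_coeff_dominated:
  assumes cont: "continuous_on UNIV v1" "continuous_on UNIV v2" and T: "0 < T"
    and first: "\<And>s. s \<in> {0..T} \<Longrightarrow> \<bar>\<sigma> * chi_coeff x v1 v2 z 1 s\<bar> \<le> \<beta>"
    and t: "t \<in> {0..T}"
  shows "\<bar>\<sigma> ^ Suc n * chi_coeff x v1 v2 z (Suc n) t\<bar> \<le> scaled_catalan (kernel_bound v1 v2 T) \<beta> n"
  using t
proof (induction n arbitrary: t rule: less_induct)
  case (less n)
  let ?b = "scaled_catalan (kernel_bound v1 v2 T) \<beta>"
  show ?case
  proof (cases n)
    case 0
    then show ?thesis using first[OF less.prems] by simp
  next
    case (Suc m)
    let ?\<chi> = "\<lambda>n s. \<sigma> ^ Suc n * chi_coeff x v1 v2 z (Suc n) s"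
    let ?h = "\<lambda>s. \<Sum>j\<le>m. ?\<chi> j s * ?\<chi> (m - j) s"
    have "\<sigma> ^ Suc n = \<sigma> ^ Suc j * \<sigma> ^ Suc (m - j)" if "j \<le> m" for j
      using that Suc by (simp flip: power_add)
    \<comment> \<open>The source is homogeneous of degree \<open>n + 1\<close> in \<open>\<sigma>\<close>, so the powers of \<open>\<sigma>\<close> can be
      distributed over its factors.\<close>
    then have source: "\<sigma> ^ Suc n * (\<Sum>j\<le>m. chi_coeff x v1 v2 z (Suc j) s
        * chi_coeff x v1 v2 z (Suc (m - j)) s) = ?h s" for s
      unfolding sum_distrib_left by (intro sum.cong) (auto simp del: power_Suc)
    have scale: "\<sigma> ^ Suc n * (green_kernel v1 v2 t s * (\<Sum>j\<le>m. chi_coeff x v1 v2 z (Suc j) s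
        * chi_coeff x v1 v2 z (Suc (m - j)) s)) = green_kernel v1 v2 t s * ?h s" for s
      by (subst mult.left_commute) (simp only: source)
    have "?\<chi> n t = \<sigma> ^ Suc n * (LBINT s=0..t. green_kernel v1 v2 t s * (\<Sum>j\<le>m.
        chi_coeff x v1 v2 z (Suc j) s * chi_coeff x v1 v2 z (Suc (m - j)) s))"
      by (simp only: Suc chi_coeff_convolution)
    also have "\<dots> = (LBINT s=0..t. green_kernel v1 v2 t s * ?h s)" (is "_ = ?I")
      by (subst interval_lebesgue_integral_mult_right[symmetric]) (simp only: scale)
    finally have eq: "?\<chi> n t = ?I" .
    have "\<bar>?I\<bar> \<le> kernel_bound v1 v2 T * (\<Sum>j\<le>m. ?b j * ?b (m - j))"
    proof (rule green_kernel_integral_le[OF cont T less.prems])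
      fix s assume "s \<in> {0..t}"
      then have IH: "\<bar>?\<chi> j s\<bar> \<le> ?b j" if "j \<le> m" for j
        using that Suc less.prems by (intro less.IH) auto
      have "\<bar>?h s\<bar> \<le> (\<Sum>j\<le>m. \<bar>?\<chi> j s\<bar> * \<bar>?\<chi> (m - j) s\<bar>)"
        using sum_abs[of "\<lambda>j. ?\<chi> j s * ?\<chi> (m - j) s" "{..m}"] by (simp only: abs_mult)
      also have "\<dots> \<le> (\<Sum>j\<le>m. ?b j * ?b (m - j))"
        by (intro sum_mono mult_mono IH order_trans[OF abs_ge_zero IH]) auto
      finally show "\<bar>?h s\<bar> \<le> (\<Sum>j\<le>m. ?b j * ?b (m - j))" .
    qed
    then show ?thesis
      unfolding eq by (simp only: Suc scaled_catalan.simps)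
  qed
qed

lemma chi_coeff_first_le:
  assumes deriv: "\<And>s. (v1 has_real_derivative v1' s) (at s)" "\<And>s. (v2 has_real_derivative v2' s) (at s)"
    and bound: "\<And>s. s \<in> {0..t} \<Longrightarrow> \<bar>v1 s\<bar> \<le> A \<and> \<bar>v2 s\<bar> \<le> A \<and> \<bar>v1' s\<bar> \<le> A \<and> \<bar>v2' s\<bar> \<le> A"
    and z: "\<And>s. s \<in> {0..t} \<Longrightarrow> \<bar>z s\<bar> \<le> B"
    and t: "0 \<le> t"
  shows "\<bar>chi_coeff x v1 v2 z 1 t\<bar> \<le> 2 * A\<^sup>2 * B * t"
proof -
  have "deriv (\<lambda>r. green_kernel v1 v2 t r) s = v2 t * v1' s - v1 t * v2' s" for s
    unfolding green_kernel_def by (rule DERIV_imp_deriv) (auto intro!: derivative_eq_intros deriv)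
  then have "chi_coeff x v1 v2 z 1 t = - (LBINT s:{0..t}. (v2 t * v1' s - v1 t * v2' s) * z s)"
    using t by (simp add: chi_coeff.simps interval_integral_Icc zero_ereal_def)
  also have "\<bar>\<dots>\<bar> \<le> (LBINT s:{0..t}. 2 * A\<^sup>2 * B)"
    unfolding abs_minus_cancel
  proof (rule abs_set_integral_le)
    show "set_integrable lborel {0..t} (\<lambda>s. 2 * A\<^sup>2 * B)"
      by (intro set_integrable_continuous continuous_intros)
    fix s assume s: "s \<in> {0..t}"
    have A: "0 \<le> A" using bound[OF s] by linarith
    have "\<bar>v2 t * v1' s - v1 t * v2' s\<bar> \<le> \<bar>v2 t * v1' s\<bar> + \<bar>v1 t * v2' s\<bar>"
      by (rule abs_triangle_ineq4)
    also have "\<dots> \<le> A * A + A * A"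
      unfolding abs_mult using bound[OF s] bound[of t] t A
      by (intro add_mono mult_mono) auto
    finally have "\<bar>v2 t * v1' s - v1 t * v2' s\<bar> \<le> 2 * A\<^sup>2"
      by (simp add: power2_eq_square)
    then show "\<bar>(v2 t * v1' s - v1 t * v2' s) * z s\<bar> \<le> 2 * A\<^sup>2 * B"
      unfolding abs_mult using z[OF s] by (intro mult_mono) auto
  qed
  also have "\<dots> = 2 * A\<^sup>2 * B * t"
    using t by (simp add: set_lebesgue_integral_def)
  finally show ?thesis .
qed

lemma nonzero_in_interval_if_deriv_nonzero:
  assumes "deriv v (T / 2) \<noteq> 0 \<or> v (T / 2) \<noteq> 0" and "0 < T"
  obtains t where "t \<in> {0..T}" "v t \<noteq> (0::real)"
proof (rule ccontr)
  assume "\<not> thesis"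
  with that have zero: "v t = 0" if "t \<in> {0..T}" for t using that by blast
  have "eventually (\<lambda>t. t \<in> {0<..<T}) (nhds (T / 2))"
    using \<open>0 < T\<close> by (intro eventually_nhds_in_open) auto
  then have "eventually (\<lambda>t. v t = 0) (nhds (T / 2))"
    by (rule eventually_mono) (use zero in auto)
  then have "deriv v (T / 2) = deriv (\<lambda>_. 0) (T / 2)"
    by (intro deriv_cong_ev) auto
  with zero[of "T / 2"] assms show False by simp
qed

text \<open>Both the kernel bound and the first coefficient are \<open>O(T)\<close>, with constants depending on the
  path only through \<open>B\<close>; so \<open>4 * N * \<beta> \<le> 1\<close> holds for small \<open>T\<close>, and one \<open>T\<close> serves all paths
  bounded by \<open>B\<close>.  The Wronskian identity keeps \<open>v1\<close> and \<open>v2\<close> from vanishing near any point, so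
  \<open>kernel_bound\<close> is strictly positive and the final bound does not degenerate to \<open>1 / 0 = 0\<close>.\<close>

lemma perturbation_series_converges_small_time:
  assumes C1: "v1 C1_differentiable_on UNIV" "v2 C1_differentiable_on UNIV"
    and Wronskian: "\<And>t. v1 t * deriv v2 t - deriv v1 t * v2 t = 1"
    and \<sigma>: "0 < \<sigma>"
  obtains T where "0 < T" "T \<le> 1"
    "\<And>z t. \<forall>s\<in>{0..1}. \<bar>z s\<bar> \<le> B \<Longrightarrow> t \<in> {0..T} \<Longrightarrow>
       summable (\<lambda>n. \<sigma> ^ Suc n * chi_coeff x v1 v2 z (Suc n) t) \<and>
       \<bar>\<Sum>n. \<sigma> ^ Suc n * chi_coeff x v1 v2 z (Suc n) t\<bar> \<le> 1 / (2 * kernel_bound v1 v2 T)"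
proof -
  obtain v1' v2' where deriv:
      "\<And>s. (v1 has_real_derivative v1' s) (at s)" "continuous_on UNIV v1'"
      "\<And>s. (v2 has_real_derivative v2' s) (at s)" "continuous_on UNIV v2'"
    using C1 unfolding C1_differentiable_on_UNIV_iff_DERIV by blast
  have cont: "continuous_on UNIV v1" "continuous_on UNIV v2"
    using C1 C1_differentiable_imp_continuous_on by blast+
  obtain A where A: "1 \<le> A"
    "\<And>s. s \<in> {0..1} \<Longrightarrow> \<bar>v1 s\<bar> \<le> A \<and> \<bar>v2 s\<bar> \<le> A \<and> \<bar>v1' s\<bar> \<le> A \<and> \<bar>v2' s\<bar> \<le> A"
  proof -
    have "continuous_on UNIV (\<lambda>s. \<bar>v1 s\<bar> + \<bar>v2 s\<bar> + \<bar>v1' s\<bar> + \<bar>v2' s\<bar>)"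
      using cont deriv by (intro continuous_intros)
    then obtain A where "\<And>s. s \<in> {0..1} \<Longrightarrow> \<bar>\<bar>v1 s\<bar> + \<bar>v2 s\<bar> + \<bar>v1' s\<bar> + \<bar>v2' s\<bar>\<bar> \<le> A"
      using continuous_on_interval_abs_bounded[where a = 0 and b = 1] by blast
    then show ?thesis by (intro that[of "max 1 A"]) (force simp: le_max_iff_disj)+
  qed
  define B' where "B' = max 1 B"
  \<comment> \<open>With \<open>kernel_bound v1 v2 T \<le> 2 A\<^sup>2 T\<close> and \<open>\<bar>\<sigma> \<chi>\<^sub>1\<bar> \<le> 2 \<sigma> A\<^sup>2 B' T\<close>, the smallness condition
    reads \<open>16 \<sigma> A\<^sup>4 B' T\<^sup>2 \<le> 1\<close>; as \<open>T \<le> 1\<close>, one power of \<open>T\<close> may be dropped.\<close>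
  define D where "D = 16 * \<sigma> * A ^ 4 * B'"
  define T where "T = min 1 (1 / D)"
  have D: "0 < D" using A(1) \<sigma> by (simp add: D_def B'_def)
  then have T: "0 < T" "T \<le> 1" "D * T \<le> 1"
    by (auto simp: T_def min_def field_simps)
  let ?N = "kernel_bound v1 v2 T"
  define \<beta> where "\<beta> = \<sigma> * (2 * A\<^sup>2 * B' * T)"
  have \<beta>: "0 \<le> \<beta>" using A(1) \<sigma> T by (simp add: \<beta>_def B'_def)
  have "?N \<le> 2 * A\<^sup>2 * T"
    by (rule kernel_bound_le[OF cont T(1)]) (use A(2) T in auto)
  then have "4 * ?N * \<beta> \<le> 4 * (2 * A\<^sup>2 * T) * \<beta>"
    using \<beta> by (intro mult_right_mono mult_left_mono) auto
  also have "\<dots> = D * T * T"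
    by (simp add: \<beta>_def D_def power2_eq_square power4_eq_xxxx)
  also have "\<dots> \<le> 1"
    using mult_le_one[of "D * T" T] T by simp
  finally have small: "4 * ?N * \<beta> \<le> 1" .
  have N: "0 < ?N"
  proof -
    have "deriv v1 (T / 2) \<noteq> 0 \<or> v1 (T / 2) \<noteq> 0" "deriv v2 (T / 2) \<noteq> 0 \<or> v2 (T / 2) \<noteq> 0"
      using Wronskian[of "T / 2"] by auto
    then show ?thesis
      using kernel_bound_pos[OF cont T(1)] T(1) by (metis nonzero_in_interval_if_deriv_nonzero)
  qed
  show ?thesis
  proof (rule that[OF T(1,2)])
    fix z :: "real \<Rightarrow> real" and t
    assume z: "\<forall>s\<in>{0..1}. \<bar>z s\<bar> \<le> B" and t: "t \<in> {0..T}"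
    have first: "\<bar>\<sigma> * chi_coeff x v1 v2 z 1 s\<bar> \<le> \<beta>" if s: "s \<in> {0..T}" for s
    proof -
      have "\<bar>z r\<bar> \<le> B'" if "r \<in> {0..1}" for r
        using bspec[OF z that] by (simp add: B'_def)
      then have "\<bar>chi_coeff x v1 v2 z 1 s\<bar> \<le> 2 * A\<^sup>2 * B' * s"
        using A(2) T(2) s deriv by (intro chi_coeff_first_le[where v1' = v1' and v2' = v2']) auto
      also have "\<dots> \<le> 2 * A\<^sup>2 * B' * T"
        using s by (intro mult_left_mono) (auto simp: B'_def)
      finally show ?thesis using \<sigma> by (simp add: abs_mult \<beta>_def)
    qed
    show "summable (\<lambda>n. \<sigma> ^ Suc n * chi_coeff x v1 v2 z (Suc n) t) \<and>
        \<bar>\<Sum>n. \<sigma> ^ Suc n * chi_coeff x v1 v2 z (Suc n) t\<bar> \<le> 1 / (2 * ?N)"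
      using dominated_by_scaled_catalan[OF N \<beta> small chi_coeff_dominated[OF cont T(1) first t]]
      by blast
  qed
qed

section \<open>An almost sure uniform bound on the noise\<close>

lemma in_Linf_imp_AE_bounded:
  assumes "in_Linf M f"
  obtains B where "AE \<omega> in M. \<bar>f \<omega>\<bar> \<le> B"
proof -
  obtain B where B: "Linf_norm M f < ereal B"
    using assms unfolding in_Linf_def by (meson ereal_dense2)
  have "AE \<omega> in M. ereal \<bar>f \<omega>\<bar> \<le> Linf_norm M f"
    unfolding Linf_norm_def by (rule esssup_AE)
  then have "AE \<omega> in M. \<bar>f \<omega>\<bar> \<le> B"
  proof (rule eventually_mono)
    fix \<omega> assume "ereal \<bar>f \<omega>\<bar> \<le> Linf_norm M f"
    from le_less_trans[OF this B] show "\<bar>f \<omega>\<bar> \<le> B" by simp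
  qed
  then show ?thesis by (rule that)
qed

text \<open>\<open>Z t\<close> is a conditional expectation of \<open>Z r\<close>, and conditional expectation preserves bounds.\<close>

lemma martingale_bounded_by_terminal_value:
  assumes "prob_space M" and martingale: "martingale_on_nonneg M F Z"
    and t: "0 \<le> t" "t \<le> r" and B: "AE \<omega> in M. \<bar>Z r \<omega>\<bar> \<le> B"
  shows "AE \<omega> in M. \<bar>Z t \<omega>\<bar> \<le> B"
proof -
  interpret prob_space M by fact
  interpret finite_measure_subalgebra M "F t"
    by unfold_locales (use martingale t in \<open>auto simp: martingale_on_nonneg_def\<close>)
  have int: "integrable M (Z r)"
    and cond: "AE \<omega> in M. real_cond_exp M (F t) (Z r) \<omega> = Z t \<omega>"
    using martingale t unfolding martingale_on_nonneg_def by auto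
  have "AE \<omega> in M. real_cond_exp M (F t) (Z r) \<omega> \<le> B"
    using B by (intro real_cond_exp_le_c int) (auto elim!: eventually_mono)
  moreover have "AE \<omega> in M. - B \<le> real_cond_exp M (F t) (Z r) \<omega>"
    using B by (intro real_cond_exp_ge_c int) (auto elim!: eventually_mono)
  ultimately show ?thesis
    using cond by eventually_elim auto
qed

text \<open>The exceptional null set of the previous lemma depends on \<open>t\<close>.  A countable union covers all
  rational times, and path continuity extends the bound to the other times.\<close>

lemma continuous_martingale_uniformly_bounded:
  assumes "prob_space M" "martingale_on_nonneg M F Z"
    and cont: "AE \<omega> in M. continuous_on {0..} (\<lambda>t. Z t \<omega>)"
    and "0 < r" "AE \<omega> in M. \<bar>Z r \<omega>\<bar> \<le> B"
  shows "AE \<omega> in M. \<forall>t\<in>{0..r}. \<bar>Z t \<omega>\<bar> \<le> B"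
proof -
  let ?S = "{0<..<r} \<inter> \<rat>"
  have dense: "closure ?S = {0..r}"
    using closure_open_Int_superset[of "{0<..<r}" "\<rat>"] \<open>0 < r\<close>
    by (simp add: Rats_closure_real)
  have "AE \<omega> in M. \<forall>t\<in>?S. \<bar>Z t \<omega>\<bar> \<le> B"
    by (intro AE_ball_countable' martingale_bounded_by_terminal_value[OF assms(1,2) _ _ assms(5)])
      (auto simp: countable_rat)
  with cont show ?thesis
  proof eventually_elim
    case (elim \<omega>)
    have "continuous_on {0..r} (\<lambda>t. \<bar>Z t \<omega>\<bar>)"
      by (intro continuous_on_rabs continuous_on_subset[OF elim(1)]) auto
    then show ?case
      using elim(2) dense by (metis continuous_le_on_closure)
  qed
qed

section \<open>Almost sure convergence of the perturbation series\<close>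

theorem theorem4p1:
  fixes a c y \<sigma> \<kappa>\<^sub>1 \<kappa>\<^sub>2 :: real
    and M :: "'a measure"
    and F :: "real \<Rightarrow> 'a measure"
    and Z :: "real \<Rightarrow> 'a \<Rightarrow> real"
    and W\<^sub>1 W\<^sub>2 :: "real \<Rightarrow> real"
    and X :: "nat \<Rightarrow> real \<Rightarrow> 'a \<Rightarrow> real"
  assumes "c < 0" and "0 < a" and "2*c + a < 0" and "c < - a - c" and "- a - c < a"
    and "y \<in> {c..- a - c}"
    and "\<sigma> > 0"
    and "\<kappa>\<^sub>1 \<noteq> 0" and "\<kappa>\<^sub>2 \<noteq> 0"
    and W1: "W\<^sub>1 = w1 a c y \<kappa>\<^sub>1"
    and W2: "W\<^sub>2 = w2 a c y \<kappa>\<^sub>2"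
    and Wronskian: "\<And>t. W\<^sub>1 t * deriv W\<^sub>2 t - deriv W\<^sub>1 t * W\<^sub>2 t = 1"
    and "prob_space M" and "complete_measure M"
    and martingale: "martingale_on_nonneg M F Z"
    and continuous: "AE \<omega> in M. continuous_on {0..} (\<lambda>t. Z t \<omega>)"
    and Z_0: "AE \<omega> in M. Z 0 \<omega> = 0"
    and bounded: "\<And>t. t \<ge> 0 \<Longrightarrow> in_Linf M (Z t)"
    and X: "\<And>n t \<omega>. X n t \<omega> = chi_coeff (x0 a c y) W\<^sub>1 W\<^sub>2 (\<lambda>s. Z s \<omega>) n t"
  shows "\<exists>T>0.
    (\<forall>t\<in>{0..T}. AE \<omega> in M. summable (\<lambda>n. \<sigma> ^ Suc n * X (Suc n) t \<omega>)) \<and>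
    (AE \<omega> in M.
       (\<forall>t\<in>{0..T}. summable (\<lambda>n. \<sigma> ^ Suc n * X (Suc n) t \<omega>)) \<and>
       (SUP t\<in>{0..T}. ereal \<bar>(X 0 t \<omega> + (\<Sum>n. \<sigma> ^ Suc n * X (Suc n) t \<omega>)) - x0 a c y t\<bar>)
         \<le> ereal (1 / (2 * kernel_bound W\<^sub>1 W\<^sub>2 T)))"
proof -
  have q: "(modulus a c)\<^sup>2 < 1"
    using assms by (intro modulus_square_less_1)
  have C1: "W\<^sub>1 C1_differentiable_on UNIV" "W\<^sub>2 C1_differentiable_on UNIV"
    unfolding W1 W2 using q by (rule C1_differentiable_w1 C1_differentiable_w2)+
  obtain B where "AE \<omega> in M. \<bar>Z 1 \<omega>\<bar> \<le> B"
    using in_Linf_imp_AE_bounded[OF bounded[of 1]] by auto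
  then have Z: "AE \<omega> in M. \<forall>t\<in>{0..1}. \<bar>Z t \<omega>\<bar> \<le> B"
    by (intro continuous_martingale_uniformly_bounded[OF \<open>prob_space M\<close> martingale continuous]) auto
  obtain T where T: "0 < T" "T \<le> 1"
    and series: "\<And>z t. \<forall>s\<in>{0..1}. \<bar>z s\<bar> \<le> B \<Longrightarrow> t \<in> {0..T} \<Longrightarrow>
       summable (\<lambda>n. \<sigma> ^ Suc n * chi_coeff (x0 a c y) W\<^sub>1 W\<^sub>2 z (Suc n) t) \<and>
       \<bar>\<Sum>n. \<sigma> ^ Suc n * chi_coeff (x0 a c y) W\<^sub>1 W\<^sub>2 z (Suc n) t\<bar> \<le> 1 / (2 * kernel_bound W\<^sub>1 W\<^sub>2 T)"
    by (rule perturbation_series_converges_small_time[OF C1 Wronskian \<open>\<sigma> > 0\<close>, of B "x0 a c y"]) (rule that)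
  have main: "AE \<omega> in M. \<forall>t\<in>{0..T}. summable (\<lambda>n. \<sigma> ^ Suc n * X (Suc n) t \<omega>) \<and>
      \<bar>(X 0 t \<omega> + (\<Sum>n. \<sigma> ^ Suc n * X (Suc n) t \<omega>)) - x0 a c y t\<bar> \<le> 1 / (2 * kernel_bound W\<^sub>1 W\<^sub>2 T)"
    using Z
  proof eventually_elim
    case (elim \<omega>)
    show ?case
    proof
      fix t assume "t \<in> {0..T}"
      from series[of "\<lambda>s. Z s \<omega>", OF elim this]
      show "summable (\<lambda>n. \<sigma> ^ Suc n * X (Suc n) t \<omega>) \<and>
        \<bar>(X 0 t \<omega> + (\<Sum>n. \<sigma> ^ Suc n * X (Suc n) t \<omega>)) - x0 a c y t\<bar> \<le> 1 / (2 * kernel_bound W\<^sub>1 W\<^sub>2 T)"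
        unfolding X chi_coeff.simps(1) add_diff_cancel_left' .
    qed
  qed
  show ?thesis
  proof (intro exI[of _ T] conjI ballI)
    show "AE \<omega> in M. summable (\<lambda>n. \<sigma> ^ Suc n * X (Suc n) t \<omega>)" if "t \<in> {0..T}" for t
      using main by (rule eventually_mono) (use that in blast)
    show "AE \<omega> in M. (\<forall>t\<in>{0..T}. summable (\<lambda>n. \<sigma> ^ Suc n * X (Suc n) t \<omega>)) \<and>
        (SUP t\<in>{0..T}. ereal \<bar>(X 0 t \<omega> + (\<Sum>n. \<sigma> ^ Suc n * X (Suc n) t \<omega>)) - x0 a c y t\<bar>)
          \<le> ereal (1 / (2 * kernel_bound W\<^sub>1 W\<^sub>2 T))"
      using main
    proof (rule eventually_mono)
      fix \<omega>
      assume *: "\<forall>t\<in>{0..T}. summable (\<lambda>n. \<sigma> ^ Suc n * X (Suc n) t \<omega>) \<and>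
        \<bar>(X 0 t \<omega> + (\<Sum>n. \<sigma> ^ Suc n * X (Suc n) t \<omega>)) - x0 a c y t\<bar> \<le> 1 / (2 * kernel_bound W\<^sub>1 W\<^sub>2 T)"
      show "(\<forall>t\<in>{0..T}. summable (\<lambda>n. \<sigma> ^ Suc n * X (Suc n) t \<omega>)) \<and>
        (SUP t\<in>{0..T}. ereal \<bar>(X 0 t \<omega> + (\<Sum>n. \<sigma> ^ Suc n * X (Suc n) t \<omega>)) - x0 a c y t\<bar>)
          \<le> ereal (1 / (2 * kernel_bound W\<^sub>1 W\<^sub>2 T))"
      proof (intro conjI SUP_least)
        show "\<forall>t\<in>{0..T}. summable (\<lambda>n. \<sigma> ^ Suc n * X (Suc n) t \<omega>)"
          using * by blast
        show "ereal \<bar>(X 0 t \<omega> + (\<Sum>n. \<sigma> ^ Suc n * X (Suc n) t \<omega>)) - x0 a c y t\<bar>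
            \<le> ereal (1 / (2 * kernel_bound W\<^sub>1 W\<^sub>2 T))" if "t \<in> {0..T}" for t
          using * that unfolding ereal_less_eq by blast
      qed
    qed
  qed (rule T(1))
qed

end
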